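(* For every even $n\ge 4$, the code $\mathcal{F}_n = \{ [n], \{1\}, \{2\}, \ldots, \{n\}, \emptyset \}\subseteq 2^{[n]}$ has $\operatorname{bdim}(\mathcal{F}_n) = n/2$, while on the other hand $\operatorname{odim}(\mathcal{F}_n) = \operatorname{cdim}(\mathcal{F}_n) = 2$.
   Context: Write $[n]=\{1,\ldots,n\}$. A code is a set $\mathcal{C}\subseteq 2^{[n]}$. For an ordered (indexed) collection $\mathcal{U} = \{U_1, \ldots, U_n\}$ of sets in $\mathbb{R}^d$, its code is $$\operatorname{code}(\mathcal{U}) = \{\sigma\subseteq [n] \mid \text{there exists } p\in \mathbb{R}^d \text{ such that for all } i\in[n],\ p\in U_i \text{ if and only if } i\in\sigma\},$$ and $\mathcal{U}$ is called a realization of $\operatorname{code}(\mathcal{U})$. By standing convention, all sets in realizations are bounded. An axis-parallel box (box for short) in $\mathbb{R}^d$ is either the empty set or a product $[a_1,b_1]\times\cdots\times[a_d,b_d]$ of nonempty closed intervals (degenerate intervals $a_i=b_i$ allowed). $\operatorname{odim}(\mathcal{C})$ (respectively $\operatorname{cdim}(\mathcal{C})$, $\operatorname{bdim}(\mathcal{C})$) is the minimum $d$ such that $\mathcal{C}$ has a realization in $\mathbb{R}^d$ in which every set is open and convex (respectively closed and convex, a box). The minimum over the empty set is $\infty$. *)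

theory Defs
  imports "HOL-Analysis.Analysis"
begin

text \<open>
  The space $\mathbb{R}^d$, for a natural number \<open>d\<close>, is the library's \<open>Euclidean_space d\<close>:
  its points are the functions \<open>x :: nat \<Rightarrow> real\<close> with \<open>x i = 0\<close> for all \<open>i \<ge> d\<close>. Thus the
  coordinates are indexed by \<open>0, \<dots>, d - 1\<close>. A type-indexed space cannot be used, since the
  minimum in the definition of the dimensions below ranges over \<open>d\<close>.
  A collection of sets indexed by $[n]$ is a function on \<open>nat\<close> of which only the values on
  \<open>{1..n}\<close> matter.
\<close>

abbreviation euclid :: "nat \<Rightarrow> (nat \<Rightarrow> real) set" where
  "euclid d \<equiv> topspace (Euclidean_space d)"

definition code_of :: "nat \<Rightarrow> nat \<Rightarrow> (nat \<Rightarrow> (nat \<Rightarrow> real) set) \<Rightarrow> nat set set" where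
  "code_of n d U = {\<sigma>. \<sigma> \<subseteq> {1..n} \<and> (\<exists>p \<in> euclid d. \<forall>i \<in> {1..n}. p \<in> U i \<longleftrightarrow> i \<in> \<sigma>)}"

text \<open>
  The type \<open>nat \<Rightarrow> real\<close> is not an instance of \<open>real_vector\<close>, and its metric in the library is not
  the Euclidean one (every set is bounded for it), so convexity and boundedness are spelled out.
\<close>

definition convex_set :: "(nat \<Rightarrow> real) set \<Rightarrow> bool" where
  "convex_set S \<longleftrightarrow>
     (\<forall>x \<in> S. \<forall>y \<in> S. \<forall>t \<in> {0..1}. (\<lambda>i. (1 - t) * x i + t * y i) \<in> S)"

definition bounded_set :: "nat \<Rightarrow> (nat \<Rightarrow> real) set \<Rightarrow> bool" where
  "bounded_set d S \<longleftrightarrow> (\<exists>B. \<forall>x \<in> S. L2_set x {..<d} \<le> B)"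

definition is_box :: "nat \<Rightarrow> (nat \<Rightarrow> real) set \<Rightarrow> bool" where
  "is_box d S \<longleftrightarrow> S = {} \<or>
     (\<exists>a b. (\<forall>i<d. a i \<le> b i) \<and> S = {x \<in> euclid d. \<forall>i<d. x i \<in> {a i..b i}})"

definition realization :: "nat \<Rightarrow> nat \<Rightarrow> (nat \<Rightarrow> (nat \<Rightarrow> real) set) \<Rightarrow> nat set set \<Rightarrow> bool" where
  "realization n d U C \<longleftrightarrow>
     (\<forall>i \<in> {1..n}. U i \<subseteq> euclid d \<and> bounded_set d (U i)) \<and> code_of n d U = C"

text \<open>
  The infimum of a nonempty set of type \<open>enat\<close> is its minimum, and the infimum of the empty set
  is \<open>\<infinity>\<close>.
\<close>

definition odim :: "nat \<Rightarrow> nat set set \<Rightarrow> enat" where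
  "odim n C = Inf {enat d | d. \<exists>U. realization n d U C \<and>
     (\<forall>i \<in> {1..n}. openin (Euclidean_space d) (U i) \<and> convex_set (U i))}"

definition cdim :: "nat \<Rightarrow> nat set set \<Rightarrow> enat" where
  "cdim n C = Inf {enat d | d. \<exists>U. realization n d U C \<and>
     (\<forall>i \<in> {1..n}. closedin (Euclidean_space d) (U i) \<and> convex_set (U i))}"

definition bdim :: "nat \<Rightarrow> nat set set \<Rightarrow> enat" where
  "bdim n C = Inf {enat d | d. \<exists>U. realization n d U C \<and> (\<forall>i \<in> {1..n}. is_box d (U i))}"

definition F_code :: "nat \<Rightarrow> nat set set" where
  "F_code n = {{1..n}} \<union> {{i} | i. i \<in> {1..n}} \<union> {{}}"

end

theory Submission
  imports Defs
begin

text \<open>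
  A family realizes \<^term>\<open>F_code n\<close> if and only if it is a sunflower: its members have a common
  point, any two of them meet only where all of them meet, and each has a point of its own.

  In dimension at most 1 three convex petals are impossible, because two of the private points lie
  on the same side of the common point. In the plane, let \<open>H j\<close> be the half-plane above the tangent
  to the parabola $y = x^2$ at \<open>x = j\<close>; the sets \<open>U i\<close> obtained by intersecting a large open square with
  all \<open>H j\<close>, \<open>j \<noteq> i\<close>, form an open sunflower, and segments from the origin form a closed one.

  For boxes, each private point leaves the common intersection through one of its \<open>2d\<close> facets, and
  two boxes leaving through the same facet would meet outside the intersection; so \<open>n \<le> 2d\<close>.
  The \<open>2d\<close> unit segments along the half-axes show that this is sharp.
\<close>

section \<open>Sunflowers and the code \<open>F_code n\<close>\<close>

lemma Inf_enat_eqI: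
  assumes "P m" and "\<And>d. P d \<Longrightarrow> m \<le> d"
  shows "Inf {enat d | d. P d} = enat m"
  using assms by (intro antisym Inf_lower Inf_greatest) auto

lemma euclid_iff: "x \<in> euclid d \<longleftrightarrow> (\<forall>i\<ge>d. x i = 0)"
  by (auto simp: topspace_Euclidean_space)

text \<open>The points \<open>p\<close>, \<open>q i\<close> and \<open>r\<close> witness the
  codewords \<open>{1..n}\<close>, \<open>{i}\<close> and \<open>{}\<close>. The first assumption
  excludes all others: a codeword with two distinct indices is full.\<close>

lemma code_of_eq_F_codeI:
  assumes "\<And>x i j k. \<lbrakk>x \<in> euclid d; i \<in> {1..n}; j \<in> {1..n}; k \<in> {1..n}; i \<noteq> j; x \<in> U i; x \<in> U j\<rbrakk>
             \<Longrightarrow> x \<in> U k"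
    and "p \<in> euclid d" "\<And>i. i \<in> {1..n} \<Longrightarrow> p \<in> U i"
    and "\<And>i. i \<in> {1..n} \<Longrightarrow> q i \<in> euclid d \<and> q i \<in> U i"
    and "\<And>i j. \<lbrakk>i \<in> {1..n}; j \<in> {1..n}; i \<noteq> j\<rbrakk> \<Longrightarrow> q i \<notin> U j"
    and "r \<in> euclid d" "\<And>i. i \<in> {1..n} \<Longrightarrow> r \<notin> U i"
  shows "code_of n d U = F_code n"
proof
  show "code_of n d U \<subseteq> F_code n"
  proof
    fix \<sigma> assume "\<sigma> \<in> code_of n d U"
    then obtain x where x: "x \<in> euclid d" "\<sigma> \<subseteq> {1..n}" "\<And>i. i \<in> {1..n} \<Longrightarrow> x \<in> U i \<longleftrightarrow> i \<in> \<sigma>"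
      unfolding code_of_def by blast
    show "\<sigma> \<in> F_code n"
    proof (cases "\<exists>i \<in> \<sigma>. \<exists>j \<in> \<sigma>. i \<noteq> j")
      case True
      then have "\<And>k. k \<in> {1..n} \<Longrightarrow> k \<in> \<sigma>"
        using assms(1)[OF x(1)] x(2,3) by blast
      then have "\<sigma> = {1..n}"
        using x(2) by blast
      then show ?thesis by (simp add: F_code_def)
    next
      case False
      then have "\<sigma> = {} \<or> (\<exists>i \<in> {1..n}. \<sigma> = {i})"
        using x(2) by blast
      then show ?thesis by (auto simp: F_code_def)
    qed
  qed
  have "{1..n} \<in> code_of n d U" "{} \<in> code_of n d U"
    unfolding code_of_def using assms(2,3,6,7) by (auto intro: bexI[of _ p] bexI[of _ r])
  moreover have "{i} \<in> code_of n d U" if "i \<in> {1..n}" for i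
  proof -
    have "\<forall>j \<in> {1..n}. q i \<in> U j \<longleftrightarrow> j \<in> {i}"
      using assms(4,5) that by blast
    then show ?thesis
      unfolding code_of_def using assms(4) that by blast
  qed
  ultimately show "F_code n \<subseteq> code_of n d U"
    unfolding F_code_def by blast
qed

lemma F_code_kernel_and_petals:
  assumes C: "code_of n d U = F_code n"
  obtains p q where "p \<in> euclid d" "\<forall>i \<in> {1..n}. p \<in> U i"
    and "\<forall>i \<in> {1..n}. q i \<in> euclid d \<and> q i \<in> U i"
    and "\<forall>i \<in> {1..n}. \<forall>j \<in> {1..n}. i \<noteq> j \<longrightarrow> q i \<notin> U j"
proof -
  have "{1..n} \<in> code_of n d U"
    unfolding C F_code_def by blast
  then obtain p where p: "p \<in> euclid d" "\<And>i. i \<in> {1..n} \<Longrightarrow> p \<in> U i"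
    unfolding code_of_def by blast
  have "\<exists>q \<in> euclid d. \<forall>j \<in> {1..n}. q \<in> U j \<longleftrightarrow> j = i" if "i \<in> {1..n}" for i
  proof -
    have "{i} \<in> code_of n d U"
      unfolding C F_code_def using that by blast
    then show ?thesis
      unfolding code_of_def by simp
  qed
  then obtain q where "\<And>i. i \<in> {1..n} \<Longrightarrow> q i \<in> euclid d"
    "\<And>i j. \<lbrakk>i \<in> {1..n}; j \<in> {1..n}\<rbrakk> \<Longrightarrow> q i \<in> U j \<longleftrightarrow> j = i"
    by metis
  then show thesis
    using p by (intro that[of p q]) auto
qed

text \<open>The codeword of \<open>x\<close> has two distinct elements, and the only such member of
  \<open>F_code n\<close> is \<open>{1..n}\<close>.\<close>

lemma F_code_meet:
  assumes C: "code_of n d U = F_code n" and x: "x \<in> euclid d" "x \<in> U i" "x \<in> U j"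
    and ijk: "i \<in> {1..n}" "j \<in> {1..n}" "k \<in> {1..n}" "i \<noteq> j"
  shows "x \<in> U k"
proof -
  define \<sigma> where "\<sigma> = {i \<in> {1..n}. x \<in> U i}"
  have "\<sigma> \<in> F_code n"
    using x(1) unfolding C [symmetric] code_of_def \<sigma>_def by blast
  then consider "\<sigma> = {1..n}" | l where "\<sigma> = {l}" | "\<sigma> = {}"
    unfolding F_code_def by blast
  moreover have "i \<in> \<sigma>" "j \<in> \<sigma>"
    using x ijk by (simp_all add: \<sigma>_def)
  ultimately have "k \<in> \<sigma>"
    using ijk by cases auto
  then show ?thesis by (simp add: \<sigma>_def)
qed

section \<open>Lower bounds for the dimension\<close>

lemma F_code_convex_dim_ge_2:
  assumes C: "code_of n d U = F_code n" and "3 \<le> n"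
    and conv: "\<And>i. i \<in> {1..n} \<Longrightarrow> convex_set (U i)"
  shows "2 \<le> d"
proof (rule ccontr)
  assume "\<not> 2 \<le> d"
  \<comment> \<open>For \<open>d = 0\<close> the coordinate \<open>x 0\<close> vanishes as well, so
    this form covers both remaining dimensions.\<close>
  then have line: "x = (\<lambda>i. if i = 0 then x 0 else 0)" if "x \<in> euclid d" for x
    using that by (auto simp: euclid_iff fun_eq_iff)
  obtain p q where p: "p \<in> euclid d" "\<forall>i \<in> {1..n}. p \<in> U i"
    and q: "\<forall>i \<in> {1..n}. q i \<in> euclid d \<and> q i \<in> U i"
    and q': "\<forall>i \<in> {1..n}. \<forall>j \<in> {1..n}. i \<noteq> j \<longrightarrow> q i \<notin> U j"
    by (rule F_code_kernel_and_petals[OF C])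
  note p = p(1) p(2)[rule_format] and q = q[rule_format] and q' = q'[rule_format]
  have between: "y \<in> U i"
    if i: "i \<in> {1..n}" and x: "x \<in> U i" "x \<in> euclid d" and y: "y \<in> euclid d"
      and b: "p 0 \<le> y 0 \<and> y 0 \<le> x 0 \<or> x 0 \<le> y 0 \<and> y 0 \<le> p 0" for i x y
  proof -
    have "y 0 \<in> closed_segment (p 0) (x 0)"
      using b by (auto simp: closed_segment_eq_real_ivl)
    then obtain t where t: "t \<in> {0..1}" "y 0 = (1 - t) * p 0 + t * x 0"
      by (auto simp: in_segment)
    have "(\<lambda>i. (1 - t) * p i + t * x i) \<in> U i"
      using conv[OF i] p(2)[OF i] x(1) t(1) unfolding convex_set_def by blast
    moreover have "(\<lambda>i. (1 - t) * p i + t * x i) = y"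
      using t(2) by (subst line[OF p(1)], subst line[OF x(2)], subst line[OF y]) auto
    ultimately show ?thesis by simp
  qed
  \<comment> \<open>Of two private points on the same side of \<open>p\<close>, the nearer one lies
    between \<open>p\<close> and the farther one, hence in a petal where it must not be.\<close>
  have sep: False
    if "i \<in> {1..n}" "j \<in> {1..n}" "i \<noteq> j"
      "q i 0 \<le> p 0 \<and> q j 0 \<le> p 0 \<or> p 0 \<le> q i 0 \<and> p 0 \<le> q j 0" for i j
    using between[of i "q i" "q j"] between[of j "q j" "q i"] q q' that by fastforce
  have "1 \<in> {1..n}" "2 \<in> {1..n}" "3 \<in> {1..n}"
    using \<open>3 \<le> n\<close> by auto
  then show False
    using sep[of 1 2] sep[of 1 3] sep[of 2 3] by force
qed

lemma F_code_box_dim_ge: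
  assumes C: "code_of n d U = F_code n" and "2 \<le> n"
    and box: "\<And>i. i \<in> {1..n} \<Longrightarrow> is_box d (U i)"
  shows "n \<le> 2 * d"
proof -
  obtain p q where p: "p \<in> euclid d" "\<forall>i \<in> {1..n}. p \<in> U i"
    and q: "\<forall>i \<in> {1..n}. q i \<in> euclid d \<and> q i \<in> U i"
    and q': "\<forall>i \<in> {1..n}. \<forall>j \<in> {1..n}. i \<noteq> j \<longrightarrow> q i \<notin> U j"
    by (rule F_code_kernel_and_petals[OF C])
  note p = p(1) p(2)[rule_format] and q = q[rule_format] and q' = q'[rule_format]
  \<comment> \<open>The empty box is excluded because \<open>p\<close> lies in every
    \<open>U i\<close>. Both bounds are packed into one pair so that a single choice over the
    indices yields them.\<close>
  have "\<exists>l. U i = {x \<in> euclid d. \<forall>k<d. fst l k \<le> x k \<and> x k \<le> snd l k}"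
    if i: "i \<in> {1..n}" for i
  proof -
    obtain a b where "U i = {x \<in> euclid d. \<forall>k<d. x k \<in> {a k..b k}}"
      using box[OF i] p(2)[OF i] unfolding is_box_def by blast
    then show ?thesis by (intro exI[of _ "(a, b)"]) simp
  qed
  then obtain l where
    l: "\<forall>i \<in> {1..n}. U i = {x \<in> euclid d. \<forall>k<d. fst (l i) k \<le> x k \<and> x k \<le> snd (l i) k}"
    using bchoice[of "{1..n}"] by meson
  define a b where "a i = fst (l i)" and "b i = snd (l i)" for i
  have U: "U i = {x \<in> euclid d. \<forall>k<d. a i k \<le> x k \<and> x k \<le> b i k}" if "i \<in> {1..n}" for i
    using l that by (simp add: a_def b_def)
  have pU: "a i k \<le> p k" "p k \<le> b i k" if "i \<in> {1..n}" "k < d" for i k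
    using p(2)[OF that(1)] U[OF that(1)] that(2) by auto
  have qU: "a i k \<le> q i k" "q i k \<le> b i k" if "i \<in> {1..n}" "k < d" for i k
    using q[OF that(1)] U[OF that(1)] that(2) by auto
  \<comment> \<open>\<open>q i\<close> leaves the common intersection through the upper (\<open>True\<close>) or lower facet in direction \<open>k\<close>\<close>
  define exits where "exits i f \<longleftrightarrow>
    (\<exists>j \<in> {1..n}. if snd f then b j (fst f) < q i (fst f) else q i (fst f) < a j (fst f))"
    for i and f :: "nat \<times> bool"
  have "\<exists>f \<in> {..<d} \<times> UNIV. exits i f" if i: "i \<in> {1..n}" for i
  proof -
    obtain j where j: "j \<in> {1..n}" "j \<noteq> i"
    proof
      show "(if i = 1 then 2 else 1) \<in> {1..n}" "(if i = 1 then 2 else 1) \<noteq> i"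
        using \<open>2 \<le> n\<close> by auto
    qed
    then obtain k where "k < d" "q i k < a j k \<or> b j k < q i k"
      using q'[OF i j(1)] q[OF i] U[OF j(1)] by force
    then have "exits i (k, False) \<or> exits i (k, True)"
      using j(1) unfolding exits_def by auto
    then show ?thesis using \<open>k < d\<close> by blast
  qed
  then obtain f where f: "\<And>i. i \<in> {1..n} \<Longrightarrow> f i \<in> {..<d} \<times> UNIV \<and> exits i (f i)"
    by metis
  \<comment> \<open>Since \<open>p\<close> satisfies all bounds, moving it along axis
    \<open>k\<close> leaves only the bounds in direction \<open>k\<close> to check.\<close>
  have upd: "p(k := t) \<in> U i \<longleftrightarrow> a i k \<le> t \<and> t \<le> b i k" if "i \<in> {1..n}" "k < d" for i k t
    using U[OF that(1)] that pU[OF that(1)] p(1) by (auto simp: euclid_iff)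
  have upd_euclid: "p(k := t) \<in> euclid d" if "k < d" for k t
    using p(1) that by (auto simp: euclid_iff)
  have "inj_on f {1..n}"
  proof (rule inj_onI, rule ccontr)
    fix i i' assume i: "i \<in> {1..n}" "i' \<in> {1..n}" "f i = f i'" "i \<noteq> i'"
    obtain k s where ks: "f i = (k, s)" by (cases "f i")
    then have k: "k < d" and e: "exits i (k, s)" "exits i' (k, s)"
      using f[OF i(1)] f[OF i(2)] i(3) by auto
    \<comment> \<open>The less distant of the two exit coordinates: it is still beyond the bound of
      some \<open>U j\<close>, yet lies between \<open>p k\<close> and both \<open>q i k\<close> and
      \<open>q i' k\<close>, so \<open>p(k := t)\<close> belongs to \<open>U i\<close> and
      \<open>U i'\<close>.\<close>
    define t where "t = (if s then min (q i k) (q i' k) else max (q i k) (q i' k))"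
    have "\<exists>j \<in> {1..n}. if s then b j k < t else t < a j k"
      using e unfolding exits_def t_def by (auto simp: min_def max_def)
    then obtain j where j: "j \<in> {1..n}" "if s then b j k < t else t < a j k"
      by blast
    have "p(k := t) \<in> U i" "p(k := t) \<in> U i'"
      using j pU[OF j(1) k] pU[OF i(1) k] pU[OF i(2) k] qU[OF i(1) k] qU[OF i(2) k]
      by (auto simp: upd[OF i(1) k] upd[OF i(2) k] t_def split: if_splits)
    then have "p(k := t) \<in> U j"
      using F_code_meet[OF C upd_euclid[OF k]] i j(1) by blast
    then show False
      using j(2) by (auto simp: upd[OF j(1) k] split: if_splits)
  qed
  moreover have "f ` {1..n} \<subseteq> {..<d} \<times> UNIV"
    using f by blast
  ultimately have "card {1..n} \<le> card ({..<d} \<times> (UNIV :: bool set))"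
    by (intro card_inj_on_le) auto
  then show ?thesis by (simp add: card_cartesian_product)
qed

section \<open>Boxes along the half-axes\<close>

lemma bounded_setI:
  assumes "\<And>x i. x \<in> S \<Longrightarrow> i < d \<Longrightarrow> \<bar>x i\<bar> \<le> B"
  shows "bounded_set d S"
  unfolding bounded_set_def
proof (intro exI ballI)
  fix x assume "x \<in> S"
  have "L2_set x {..<d} \<le> (\<Sum>i<d. \<bar>x i\<bar>)"
    by (rule L2_set_le_sum_abs)
  also have "\<dots> \<le> (\<Sum>i<d. B)"
    using assms[OF \<open>x \<in> S\<close>] by (intro sum_mono) auto
  finally show "L2_set x {..<d} \<le> (\<Sum>i<d. B)" .
qed

lemma F_code_box_realization:
  assumes "0 < m"
  shows "\<exists>U. realization (2 * m) m U (F_code (2 * m)) \<and> (\<forall>i \<in> {1..2 * m}. is_box m (U i))"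
proof -
  \<comment> \<open>Indices \<open>2 * k + 1\<close> and \<open>2 * k + 2\<close> share axis
    \<open>k\<close>: the odd one gets the segment from 0 to 1, the even one the segment from -1 to
    0.\<close>
  define c :: "nat \<Rightarrow> nat" where "c i = (i - 1) div 2" for i
  define lo hi :: "nat \<Rightarrow> nat \<Rightarrow> real"
    where "lo i k = (if even i \<and> k = c i then -1 else 0)"
      and "hi i k = (if odd i \<and> k = c i then 1 else 0)" for i k
  define U where "U i = {x \<in> euclid m. \<forall>k<m. x k \<in> {lo i k..hi i k}}" for i
  \<comment> \<open>In each coordinate at least one of the two bounds is 0, so their sum is the
    endpoint of the segment away from the origin.\<close>
  define q where "q i k = lo i k + hi i k" for i k
  have lohi: "-1 \<le> lo i k" "lo i k \<le> 0" "0 \<le> hi i k" "hi i k \<le> 1" for i k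
    unfolding lo_def hi_def by auto
  have less: "c i < m" if "i \<in> {1..2 * m}" for i
    using that by (auto simp: c_def)
  have facet: "c i \<noteq> c j \<or> even i \<noteq> even j"
    if "i \<in> {1..2 * m}" "j \<in> {1..2 * m}" "i \<noteq> j" for i j
  proof -
    have "2 * c l + (if even l then 2 else 1) = l" if "l \<in> {1..2 * m}" for l
      using that unfolding c_def atLeastAtMost_iff by presburger
    from this[OF that(1)] this[OF that(2)] show ?thesis
      using that(3) by presburger
  qed
  have "lo i k = 0 \<or> lo j k = 0" "hi i k = 0 \<or> hi j k = 0"
    if "i \<in> {1..2 * m}" "j \<in> {1..2 * m}" "i \<noteq> j" for i j k
    using facet[OF that] unfolding lo_def hi_def by auto
  then have zero: "x = (\<lambda>k. 0)"
    if "i \<in> {1..2 * m}" "j \<in> {1..2 * m}" "i \<noteq> j" "x \<in> U i" "x \<in> U j" for i j x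
    using that(4,5) that(1-3) unfolding U_def euclid_iff fun_eq_iff
    by (smt (verit) atLeastAtMost_iff mem_Collect_eq not_le)
  have zeroU: "(\<lambda>k. 0) \<in> U i" for i
    using lohi by (auto simp: U_def euclid_iff)
  have qU: "q i \<in> euclid m \<and> q i \<in> U i" if "i \<in> {1..2 * m}" for i
    using less[OF that] by (auto simp: U_def q_def euclid_iff lo_def hi_def)
  have "code_of (2 * m) m U = F_code (2 * m)"
  \<comment> \<open>As \<open>m\<close> is positive, coordinate 0 exists, and the value 2 there
    exceeds every upper bound.\<close>
  proof (rule code_of_eq_F_codeI[where p = "\<lambda>k. 0" and q = "q" and r = "\<lambda>k. if k = 0 then 2 else 0"])
    show "(\<lambda>k. 0) \<in> euclid m" "(\<lambda>k. if k = 0 then 2 else 0) \<in> euclid m"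
      using assms by (auto simp: euclid_iff)
    show "q i \<notin> U j" if "i \<in> {1..2 * m}" "j \<in> {1..2 * m}" "i \<noteq> j" for i j
    proof
      assume "q i \<in> U j"
      then have "q i = (\<lambda>k. 0)"
        using zero[OF that] qU[OF that(1)] by blast
      then have "q i (c i) = 0" by simp
      then show False
        by (auto simp: q_def lo_def hi_def split: if_splits)
    qed
    show "(\<lambda>k. if k = 0 then 2 else 0) \<notin> U i" for i
      using assms lohi(4)[of i 0] by (auto simp: U_def intro!: exI[of _ 0])
  qed (use zero zeroU qU in blast)+
  moreover have "bounded_set m (U i)" for i
  proof (rule bounded_setI)
    fix x k assume "x \<in> U i" "k < m"
    then have "lo i k \<le> x k" "x k \<le> hi i k" by (auto simp: U_def)
    then show "\<bar>x k\<bar> \<le> 1" using lohi(1,4)[of i k] by linarith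
  qed
  moreover have "is_box m (U i)" for i
    unfolding is_box_def
  proof (intro disjI2 exI conjI)
    show "\<forall>k<m. lo i k \<le> hi i k"
      using lohi(2,3) order_trans by blast
  qed (rule U_def)
  moreover have "U i \<subseteq> euclid m" for i
    unfolding U_def by blast
  ultimately show ?thesis
    unfolding realization_def by blast
qed

section \<open>Open and closed polygons\<close>

lemma convex_combination_in_euclid:
  assumes "x \<in> euclid d" "y \<in> euclid d"
  shows "(\<lambda>i. s * x i + t * y i) \<in> euclid d"
  using assms by (simp add: euclid_iff)

text \<open>A triple \<open>(a, b, c)\<close> encodes the half-plane where
  \<open>a * x 0 + b * x 1\<close> is at most, or less than, \<open>c\<close>; a finite set of
  triples thus describes a polygon.\<close>

definition halfplane_lhs :: "real \<times> real \<times> real \<Rightarrow> (nat \<Rightarrow> real) \<Rightarrow> real" where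
  "halfplane_lhs h x = fst h * x 0 + fst (snd h) * x 1 - snd (snd h)"

lemma halfplane_lhs_simp [simp]: "halfplane_lhs (a, b, c) x = a * x 0 + b * x 1 - c"
  by (simp add: halfplane_lhs_def)

lemma halfplane_lhs_convex_combination:
  "halfplane_lhs h (\<lambda>i. (1 - t) * x i + t * y i)
    = (1 - t) * halfplane_lhs h x + t * halfplane_lhs h y"
  by (simp add: halfplane_lhs_def algebra_simps)

lemma continuous_on_halfplane_lhs: "continuous_on UNIV (halfplane_lhs h)"
  unfolding halfplane_lhs_def [abs_def] by (intro continuous_intros continuous_on_product_coordinates)

text \<open>A finite intersection of open half-spaces is open in the product topology, of which
  \<open>Euclidean_space d\<close> carries the subspace topology.\<close>

lemma openin_polygon:
  assumes "finite A"
  shows "openin (Euclidean_space d) {x \<in> euclid d. \<forall>h \<in> A. halfplane_lhs h x < 0}"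
proof -
  have "open (\<Inter>h\<in>A. {x. halfplane_lhs h x < 0})"
    using assms by (intro open_INT ballI open_Collect_less continuous_on_halfplane_lhs continuous_on_const)
  moreover have "{x \<in> euclid d. \<forall>h \<in> A. halfplane_lhs h x < 0}
    = (\<Inter>h\<in>A. {x. halfplane_lhs h x < 0}) \<inter> {x. \<forall>i\<ge>d. x i = 0}"
    by (auto simp: euclid_iff)
  ultimately show ?thesis
    unfolding Euclidean_space_def openin_subtopology euclidean_product_topology
      open_openin [symmetric]
    by (intro exI conjI)
qed

lemma closedin_polygon:
  "closedin (Euclidean_space d) {x \<in> euclid d. \<forall>h \<in> A. halfplane_lhs h x \<le> 0}"
proof -
  have "closed (\<Inter>h\<in>A. {x. halfplane_lhs h x \<le> 0})"
    by (intro closed_INT ballI closed_Collect_le continuous_on_halfplane_lhs continuous_on_const)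
  moreover have "{x \<in> euclid d. \<forall>h \<in> A. halfplane_lhs h x \<le> 0}
    = euclid d \<inter> (\<Inter>h\<in>A. {x. halfplane_lhs h x \<le> 0})"
    by auto
  ultimately show ?thesis
    by (simp add: closedin_Euclidean_space_iff closed_Int
        closedin_Euclidean_imp_closed [OF closedin_topspace])
qed

lemma convex_set_open_polygon: "convex_set {x \<in> euclid d. \<forall>h \<in> A. halfplane_lhs h x < 0}"
proof -
  have "(1 - t) * u + t * v < 0" if "u < 0" "v < 0" "0 \<le> t" "t \<le> 1" for t u v :: real
    using convex_bound_lt[of u 0 v "1 - t" t] that by simp
  then show ?thesis
    by (simp add: convex_set_def halfplane_lhs_convex_combination convex_combination_in_euclid)
qed

lemma convex_set_closed_polygon: "convex_set {x \<in> euclid d. \<forall>h \<in> A. halfplane_lhs h x \<le> 0}"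
proof -
  have "(1 - t) * u + t * v \<le> 0" if "u \<le> 0" "v \<le> 0" "0 \<le> t" "t \<le> 1" for t u v :: real
    using convex_bound_le[of u 0 v "1 - t" t] that by simp
  then show ?thesis
    by (simp add: convex_set_def halfplane_lhs_convex_combination convex_combination_in_euclid)
qed

section \<open>Convex realizations in the plane\<close>

definition plane_point :: "real \<Rightarrow> real \<Rightarrow> nat \<Rightarrow> real" where
  "plane_point a b = (\<lambda>i. if i = 0 then a else if i = 1 then b else 0)"

lemma plane_point_simps [simp]:
  "plane_point a b 0 = a" "plane_point a b (Suc 0) = b" "plane_point a b \<in> euclid 2"
  by (auto simp: plane_point_def euclid_iff)

lemma bounded_set_planeI:
  assumes "\<And>x. x \<in> S \<Longrightarrow> \<bar>x 0\<bar> \<le> B \<and> \<bar>x 1\<bar> \<le> B"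
  shows "bounded_set 2 S"
  using assms by (intro bounded_setI[where B = B]) (auto simp: less_2_cases_iff)

lemma F_code_closed_realization:
  "\<exists>U. realization n 2 U (F_code n) \<and>
    (\<forall>i \<in> {1..n}. closedin (Euclidean_space 2) (U i) \<and> convex_set (U i))"
proof -
  \<comment> \<open>These constraints cut out the segment from the origin to the point
    \<open>(1, i)\<close>; distinct slopes make two such segments meet only at the origin.\<close>
  define A :: "nat \<Rightarrow> (real \<times> real \<times> real) set"
    where "A i = {(-1, 0, 0), (1, 0, 1), (real i, -1, 0), (- real i, 1, 0)}" for i
  define U where "U i = {x \<in> euclid 2. \<forall>h \<in> A i. halfplane_lhs h x \<le> 0}" for i
  have U: "x \<in> U i \<longleftrightarrow> x \<in> euclid 2 \<and> 0 \<le> x 0 \<and> x 0 \<le> 1 \<and> x 1 = real i * x 0" for x i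
    by (auto simp: U_def A_def)
  have "code_of n 2 U = F_code n"
  proof (rule code_of_eq_F_codeI[where p = "plane_point 0 0" and q = "\<lambda>i. plane_point 1 (real i)" and r = "plane_point 2 0"])
    show "x \<in> U k" if "i \<noteq> j" "x \<in> U i" "x \<in> U j" for x i j k
      using that by (auto simp: U)
    show "plane_point 0 0 \<in> euclid 2" "plane_point 2 0 \<in> euclid 2" by simp_all
    show "plane_point 0 0 \<in> U i" "plane_point 2 0 \<notin> U i" for i
      by (auto simp: U)
    show "plane_point 1 (real i) \<in> euclid 2 \<and> plane_point 1 (real i) \<in> U i" for i
      by (simp add: U)
    show "plane_point 1 (real i) \<notin> U j" if "i \<noteq> j" for i j
      using that by (simp add: U)
  qed
  moreover have "bounded_set 2 (U i)" for i
  proof (rule bounded_set_planeI)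
    fix x assume "x \<in> U i"
    then show "\<bar>x 0\<bar> \<le> real i + 1 \<and> \<bar>x 1\<bar> \<le> real i + 1"
      using mult_left_le[of "x 0" "real i"] by (auto simp: U)
  qed
  ultimately have "realization n 2 U (F_code n)"
    by (auto simp: realization_def U_def)
  then show ?thesis
    unfolding U_def using closedin_polygon convex_set_closed_polygon by blast
qed

lemma F_code_open_realization:
  "\<exists>U. realization n 2 U (F_code n) \<and>
    (\<forall>i \<in> {1..n}. openin (Euclidean_space 2) (U i) \<and> convex_set (U i))"
proof -
  \<comment> \<open>Large enough for the square of half-width \<open>M\<close> to contain every
    \<open>q i\<close>.\<close>
  define M where "M = (real n)\<^sup>2 + 2"
  define A :: "nat \<Rightarrow> (real \<times> real \<times> real) set"
    where "A i = {(1, 0, M), (-1, 0, M), (0, 1, M), (0, -1, M)}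
      \<union> (\<lambda>j. (2 * real j, -1, (real j)\<^sup>2)) ` ({1..n} - {i})" for i
  define U where "U i = {x \<in> euclid 2. \<forall>h \<in> A i. halfplane_lhs h x < 0}" for i
  \<comment> \<open>This point is 1/2 below the parabola at \<open>x = i\<close>, hence below the
    tangent there. At \<open>x = i\<close> the tangent at \<open>j\<close> runs
    \<open>(i - j)^2\<close>, thus at least 1, below the parabola, so \<open>q i\<close> is above
    all other tangents.\<close>
  define q where "q i = plane_point (real i) ((real i)\<^sup>2 - 1 / 2)" for i
  have U: "x \<in> U i \<longleftrightarrow> x \<in> euclid 2 \<and> \<bar>x 0\<bar> < M \<and> \<bar>x 1\<bar> < M \<and>
      (\<forall>j \<in> {1..n} - {i}. 2 * real j * x 0 - (real j)\<^sup>2 < x 1)" for x i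
    by (auto simp: U_def A_def abs_less_iff algebra_simps)
  have M: "2 \<le> M" "\<And>i. i \<in> {1..n} \<Longrightarrow> real i < M \<and> (real i)\<^sup>2 < M"
  proof -
    show "2 \<le> M" by (simp add: M_def)
    fix i assume "i \<in> {1..n}"
    then have "(real i)\<^sup>2 \<le> (real n)\<^sup>2" "real i \<le> (real i)\<^sup>2"
      by (auto simp: power2_eq_square mult_mono)
    then show "real i < M \<and> (real i)\<^sup>2 < M"
      unfolding M_def by linarith
  qed
  have below: "2 * real j * real i - (real j)\<^sup>2 < (real i)\<^sup>2 - 1 / 2" if "i \<noteq> j" for i j
  proof -
    have "1 \<le> \<bar>real i - real j\<bar>"
      using that by linarith
    then have "1 \<le> (real i - real j)\<^sup>2"
      by (metis abs_le_square_iff abs_one one_power2)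
    then show ?thesis
      by (simp add: power2_diff algebra_simps)
  qed
  have "code_of n 2 U = F_code n"
  \<comment> \<open>The origin is above every tangent because \<open>j\<close> is at least 1, and
    \<open>plane_point 0 M\<close> is on the boundary of the open square.\<close>
  proof (rule code_of_eq_F_codeI[where p = "plane_point 0 0" and q = "q" and r = "plane_point 0 M"])
    \<comment> \<open>\<open>U i\<close> omits only the tangent at \<open>i\<close> and
      \<open>U j\<close> only the one at \<open>j\<close>, so together they impose all the
      constraints.\<close>
    show "x \<in> U k" if "i \<noteq> j" "x \<in> U i" "x \<in> U j" for x i j k
      using that by (auto simp: U)
    show "plane_point 0 0 \<in> euclid 2" "plane_point 0 M \<in> euclid 2" by simp_all
    show "plane_point 0 0 \<in> U i" "plane_point 0 M \<notin> U i" for i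
      using M(1) by (auto simp: U)
    show "q i \<in> euclid 2 \<and> q i \<in> U i" if "i \<in> {1..n}" for i
    proof -
      have "0 \<le> (real i)\<^sup>2" by simp
      then have "\<bar>(real i)\<^sup>2 - 1 / 2\<bar> < M"
        using M(1) M(2)[OF that] by linarith
      then show ?thesis
        using M(2)[OF that] below by (auto simp: U q_def)
    qed
    show "q i \<notin> U j" if "i \<in> {1..n}" "j \<in> {1..n}" "i \<noteq> j" for i j
      using that by (auto simp: U q_def power2_eq_square intro!: bexI[of _ i])
  qed
  moreover have "bounded_set 2 (U i)" for i
    by (rule bounded_set_planeI[where B = M]) (auto simp: U)
  ultimately have "realization n 2 U (F_code n)"
    by (auto simp: realization_def U_def)
  moreover have "finite (A i)" for i
    by (simp add: A_def)
  ultimately show ?thesis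
    unfolding U_def using openin_polygon convex_set_open_polygon by blast
qed

theorem theorem15:
  fixes n :: nat
  assumes "even n" and "n \<ge> 4"
  shows "bdim n (F_code n) = enat (n div 2) \<and> odim n (F_code n) = 2 \<and> cdim n (F_code n) = 2"
proof (intro conjI)
  \<comment> \<open>Evenness gives \<open>2 * (n div 2) = n\<close>, so the boxes along the
    half-axes attain the lower bound exactly.\<close>
  have "\<exists>U. realization n (n div 2) U (F_code n) \<and> (\<forall>i \<in> {1..n}. is_box (n div 2) (U i))"
    using F_code_box_realization[of "n div 2"] assms by simp
  moreover have "n div 2 \<le> d"
    if "realization n d U (F_code n)" "\<forall>i \<in> {1..n}. is_box d (U i)" for d U
    using F_code_box_dim_ge[of n d U] that assms by (auto simp: realization_def)
  ultimately show "bdim n (F_code n) = enat (n div 2)"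
    unfolding bdim_def by (intro Inf_enat_eqI) blast+
  have ge2: "2 \<le> d"
    if "realization n d U (F_code n)" "\<forall>i \<in> {1..n}. convex_set (U i)" for d U
    using F_code_convex_dim_ge_2[of n d U] that assms by (auto simp: realization_def)
  have two: "(2 :: enat) = enat 2"
    by (simp add: numeral_eq_enat)
  show "odim n (F_code n) = 2"
    unfolding odim_def two using F_code_open_realization ge2 by (intro Inf_enat_eqI) blast+
  show "cdim n (F_code n) = 2"
    unfolding cdim_def two using F_code_closed_realization ge2 by (intro Inf_enat_eqI) blast+
qed

end
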